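(* Let $\mathcal{O}\subseteq\mathbb{R}^d$ be a possibly unbounded open subset, let $\Sigma\subseteq\partial\mathcal{O}$ be relatively open, and let $\mathfrak{a}$ be a bilinear map on $H^1(\mathcal{O},\mathfrak{w})$. Let $\varphi\in C^2(\mathcal{O})$ obey $0<\varphi\le 1$ on $\mathcal{O}$ and let $B:H^1(\mathcal{O},\mathfrak{w})\to L^2(\mathcal{O},\mathfrak{w})$ be the first-order differential operator defined by $$\mathfrak{a}(\varphi u,v)+(B\varphi u,v)_{L^2(\mathcal{O},\mathfrak{w})}=\mathfrak{a}(u,\varphi v),\quad\forall\,u\in H^1(\mathcal{O},\mathfrak{w}),\ v\in H^1_0(\mathcal{O}\cup\Sigma,\mathfrak{w}).$$ Assume that the bilinear map $$\hat{\mathfrak{a}}(u,v):=\mathfrak{a}(u,v)+(Bu,v)_{L^2(\mathcal{O},\mathfrak{w})},\quad\forall\,u,v\in H^1(\mathcal{O},\mathfrak{w}),$$ obeys the weak maximum principle property on $\mathcal{O}\cup\Sigma$ for functions $u\in H^1(\mathcal{O},\mathfrak{w})$ which are essentially bounded above. Then $\mathfrak{a}$ has the weak maximum principle property on $\mathcal{O}\cup\Sigma$ for functions $u\in H^1(\mathcal{O},\mathfrak{w})$ obeying the growth condition $$u\le C(1+\varphi^{-1})\quad\text{a.e. on }\mathcal{O}$$ for some constant $C$.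
   Context: A weight function on $\mathcal{O}$ is an element of $C(\mathcal{O})\cap L^1(\mathcal{O})$ that is positive on $\mathcal{O}$. Given weight functions $\mathfrak{w}_{0,0},\mathfrak{w}_{1,0},\mathfrak{w}_{1,1}$, $H^1(\mathcal{O},\mathfrak{w})$ is the completion of $C^\infty_0(\bar{\mathcal{O}})$ in the norm $\|u\|^2=\int_{\mathcal{O}}(|Du|^2\mathfrak{w}_{1,1}+|u|^2\mathfrak{w}_{1,0})\,dx$, and $L^2(\mathcal{O},\mathfrak{w})$ has the norm $\|u\|^2=\int_{\mathcal{O}}|u|^2\mathfrak{w}_{0,0}\,dx$. $C^\infty_0(\mathcal{O}\cup\Sigma)$ is the space of smooth functions with compact support in $\mathcal{O}\cup\Sigma$, and $H^1_0(\mathcal{O}\cup\Sigma,\mathfrak{w})$ is its closure in $H^1(\mathcal{O},\mathfrak{w})$. "$u\le 0$ on $\partial\mathcal{O}\setminus\Sigma$ in the sense of $H^1(\mathcal{O},\mathfrak{w})$" means $u^+\in H^1_0(\mathcal{O}\cup\Sigma,\mathfrak{w})$. The identity defining $B$ presupposes that multiplication by $\varphi$ maps $H^1(\mathcal{O},\mathfrak{w})$ to itself and $H^1_0(\mathcal{O}\cup\Sigma,\mathfrak{w})$ to itself. (When $\mathfrak{a}(u,v)=(Au,v)_{L^2(\mathcal{O},\mathfrak{w})}$ for a second-order differential operator $A$ and smooth $u,v$, one has $B(\varphi u)=-[A,\varphi]u$.) Weak maximum principle property: a bilinear map $\mathfrak{b}$ on $H^1(\mathcal{O},\mathfrak{w})$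 obeys it on $\mathcal{O}\cup\Sigma$ for a class $\mathfrak{K}\subset H^1(\mathcal{O},\mathfrak{w})$ if whenever $u\in\mathfrak{K}$ obeys $\mathfrak{b}(u,v)\le 0$ for all $v\in H^1_0(\mathcal{O}\cup\Sigma,\mathfrak{w})$ with $v\ge 0$ a.e. on $\mathcal{O}$, and $u\le 0$ on $\partial\mathcal{O}\setminus\Sigma$ in the sense of $H^1(\mathcal{O},\mathfrak{w})$, then $u\le 0$ a.e. on $\mathcal{O}$. *)

theory Defs
  imports "HOL-Analysis.Analysis"
begin

text \<open>
  Functions on the open set \<open>\<O>\<close> are represented by total functions on the ambient Euclidean
  space; their values outside \<open>\<O>\<close> never matter. Elements of the Lebesgue and Sobolev spaces are
  represented by functions, and everything that lives on these spaces is required to respect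
  equality almost everywhere on \<open>\<O>\<close>.
\<close>

primrec iter_partial :: "'a list \<Rightarrow> ('a::euclidean_space \<Rightarrow> real) \<Rightarrow> 'a \<Rightarrow> real" where
  "iter_partial [] f = f"
| "iter_partial (b # bs) f = (\<lambda>x. frechet_derivative (iter_partial bs f) (at x) b)"

definition grad :: "('a::euclidean_space \<Rightarrow> real) \<Rightarrow> 'a \<Rightarrow> 'a" where
  "grad f x = (\<Sum>b\<in>Basis. frechet_derivative f (at x) b *\<^sub>R b)"

text \<open>The next two definitions are meant for open \<open>\<O>\<close>.\<close>

definition C_k :: "nat \<Rightarrow> 'a::euclidean_space set \<Rightarrow> ('a \<Rightarrow> real) \<Rightarrow> bool" where
  "C_k k \<O> f \<longleftrightarrow>
     (\<forall>bs \<in> lists Basis.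
        (length bs < k \<longrightarrow> iter_partial bs f differentiable_on \<O>) \<and>
        (length bs \<le> k \<longrightarrow> continuous_on \<O> (iter_partial bs f)))"

text \<open>
  For \<open>\<O> \<subseteq> S \<subseteq> closure \<O>\<close>: smooth in \<open>\<O>\<close>, with all partial derivatives extending
  continuously to \<open>S\<close>, and vanishing outside a compact subset of \<open>S\<close>.
  The set \<open>S\<close> is \<open>closure \<O>\<close> or \<open>\<O> \<union> \<Sigma>\<close> below.
\<close>

definition test_functions :: "'a::euclidean_space set \<Rightarrow> 'a set \<Rightarrow> ('a \<Rightarrow> real) set" where
  "test_functions \<O> S =
     {f. (\<forall>bs \<in> lists Basis.
            iter_partial bs f differentiable_on \<O> \<and>
            (\<exists>F. continuous_on S F \<and> (\<forall>x\<in>\<O>. F x = iter_partial bs f x))) \<and>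
         (\<exists>K. compact K \<and> K \<subseteq> S \<and> (\<forall>x \<in> \<O> - K. f x = 0))}"

definition weight_function :: "'a::euclidean_space set \<Rightarrow> ('a \<Rightarrow> real) \<Rightarrow> bool" where
  "weight_function \<O> w \<longleftrightarrow>
     continuous_on \<O> w \<and> integrable (lebesgue_on \<O>) w \<and> (\<forall>x\<in>\<O>. 0 < w x)"

definition L2 :: "'a::euclidean_space set \<Rightarrow> ('a \<Rightarrow> real) \<Rightarrow> ('a \<Rightarrow> real) set" where
  "L2 \<O> w00 =
     {f \<in> borel_measurable (lebesgue_on \<O>). integrable (lebesgue_on \<O>) (\<lambda>x. (f x)\<^sup>2 * w00 x)}"

definition L2_inner ::
    "'a::euclidean_space set \<Rightarrow> ('a \<Rightarrow> real) \<Rightarrow> ('a \<Rightarrow> real) \<Rightarrow> ('a \<Rightarrow> real) \<Rightarrow> real" where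
  "L2_inner \<O> w00 f g = (LINT x|lebesgue_on \<O>. f x * g x * w00 x)"

text \<open>Convergence of \<open>(\<psi> n, D (\<psi> n))\<close> to \<open>(u, g)\<close> in the weighted Sobolev norm.\<close>

definition H1_converges ::
    "'a::euclidean_space set \<Rightarrow> ('a \<Rightarrow> real) \<Rightarrow> ('a \<Rightarrow> real) \<Rightarrow>
     (nat \<Rightarrow> 'a \<Rightarrow> real) \<Rightarrow> ('a \<Rightarrow> real) \<Rightarrow> ('a \<Rightarrow> 'a) \<Rightarrow> bool" where
  "H1_converges \<O> w10 w11 \<psi> u g \<longleftrightarrow>
     (\<lambda>n. \<integral>\<^sup>+ x. ennreal ((norm (grad (\<psi> n) x - g x))\<^sup>2 * w11 x + (\<psi> n x - u x)\<^sup>2 * w10 x)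
            \<partial>lebesgue_on \<O>) \<longlonglongrightarrow> 0"

text \<open>
  The completion of \<open>test_functions \<O> (closure \<O>)\<close> in the weighted Sobolev norm is realised as the
  closure of the pairs \<open>(\<psi>, D\<psi>)\<close> in the product of the weighted \<open>L\<^sup>2\<close> spaces. As the weights are
  positive and continuous, they are bounded below on compact subsets of \<open>\<O>\<close>, so in such
  a pair \<open>(u, g)\<close> the field \<open>g\<close> is the weak gradient of \<open>u\<close>. It is thus determined by \<open>u\<close>
  up to null sets, and the completion is a space of functions.
\<close>

definition has_H1_gradient ::
    "'a::euclidean_space set \<Rightarrow> ('a \<Rightarrow> real) \<Rightarrow> ('a \<Rightarrow> real) \<Rightarrow> ('a \<Rightarrow> real) \<Rightarrow> ('a \<Rightarrow> 'a) \<Rightarrow> bool" where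
  "has_H1_gradient \<O> w10 w11 u g \<longleftrightarrow>
     u \<in> borel_measurable (lebesgue_on \<O>) \<and> g \<in> borel_measurable (lebesgue_on \<O>) \<and>
     (\<exists>\<psi>. (\<forall>n. \<psi> n \<in> test_functions \<O> (closure \<O>)) \<and> H1_converges \<O> w10 w11 \<psi> u g)"

definition H1 ::
    "'a::euclidean_space set \<Rightarrow> ('a \<Rightarrow> real) \<Rightarrow> ('a \<Rightarrow> real) \<Rightarrow> ('a \<Rightarrow> real) set" where
  "H1 \<O> w10 w11 = {u. \<exists>g. has_H1_gradient \<O> w10 w11 u g}"

definition H1_0 ::
    "'a::euclidean_space set \<Rightarrow> 'a set \<Rightarrow> ('a \<Rightarrow> real) \<Rightarrow> ('a \<Rightarrow> real) \<Rightarrow> ('a \<Rightarrow> real) set" where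
  "H1_0 \<O> \<Sigma> w10 w11 =
     {u. \<exists>g. has_H1_gradient \<O> w10 w11 u g \<and>
        (\<exists>\<psi>. (\<forall>n. \<psi> n \<in> test_functions \<O> (\<O> \<union> \<Sigma>)) \<and> H1_converges \<O> w10 w11 \<psi> u g)}"

definition bilinear_map_on_H1 ::
    "'a::euclidean_space set \<Rightarrow> ('a \<Rightarrow> real) \<Rightarrow> ('a \<Rightarrow> real) \<Rightarrow>
     (('a \<Rightarrow> real) \<Rightarrow> ('a \<Rightarrow> real) \<Rightarrow> real) \<Rightarrow> bool" where
  "bilinear_map_on_H1 \<O> w10 w11 \<bb> \<longleftrightarrow>
     (\<forall>u\<in>H1 \<O> w10 w11. \<forall>u'\<in>H1 \<O> w10 w11. \<forall>v\<in>H1 \<O> w10 w11.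
        \<bb> (\<lambda>x. u x + u' x) v = \<bb> u v + \<bb> u' v \<and>
        \<bb> v (\<lambda>x. u x + u' x) = \<bb> v u + \<bb> v u') \<and>
     (\<forall>u\<in>H1 \<O> w10 w11. \<forall>v\<in>H1 \<O> w10 w11. \<forall>c.
        \<bb> (\<lambda>x. c * u x) v = c * \<bb> u v \<and> \<bb> u (\<lambda>x. c * v x) = c * \<bb> u v) \<and>
     (\<forall>u\<in>H1 \<O> w10 w11. \<forall>u'\<in>H1 \<O> w10 w11. \<forall>v\<in>H1 \<O> w10 w11. \<forall>v'\<in>H1 \<O> w10 w11.
        (AE x in lebesgue_on \<O>. u x = u' x) \<longrightarrow> (AE x in lebesgue_on \<O>. v x = v' x) \<longrightarrow>
        \<bb> u v = \<bb> u' v')"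

text \<open>
  An operator \<open>H1 \<rightarrow> L2\<close> of the form \<open>B u = \<beta> \<bullet> Du + \<gamma> u\<close> a.e. on \<open>\<O>\<close>, with measurable
  coefficients. Linearity and compatibility with a.e. equality follow from this form.
\<close>

definition first_order_operator ::
    "'a::euclidean_space set \<Rightarrow> ('a \<Rightarrow> real) \<Rightarrow> ('a \<Rightarrow> real) \<Rightarrow> ('a \<Rightarrow> real) \<Rightarrow>
     (('a \<Rightarrow> real) \<Rightarrow> ('a \<Rightarrow> real)) \<Rightarrow> bool" where
  "first_order_operator \<O> w00 w10 w11 B \<longleftrightarrow>
     (\<forall>u\<in>H1 \<O> w10 w11. B u \<in> L2 \<O> w00) \<and>
     (\<exists>\<beta> \<gamma>. \<beta> \<in> borel_measurable (lebesgue_on \<O>) \<and> \<gamma> \<in> borel_measurable (lebesgue_on \<O>) \<and>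
        (\<forall>u g. has_H1_gradient \<O> w10 w11 u g \<longrightarrow>
           (AE x in lebesgue_on \<O>. B u x = \<beta> x \<bullet> g x + \<gamma> x * u x)))"

text \<open>\<open>u \<le> 0\<close> on \<open>frontier \<O> - \<Sigma>\<close> in the sense of \<open>H1\<close>\<close>

definition boundary_nonpos ::
    "'a::euclidean_space set \<Rightarrow> 'a set \<Rightarrow> ('a \<Rightarrow> real) \<Rightarrow> ('a \<Rightarrow> real) \<Rightarrow> ('a \<Rightarrow> real) \<Rightarrow> bool" where
  "boundary_nonpos \<O> \<Sigma> w10 w11 u \<longleftrightarrow> (\<lambda>x. max (u x) 0) \<in> H1_0 \<O> \<Sigma> w10 w11"

definition weak_max_principle ::
    "'a::euclidean_space set \<Rightarrow> 'a set \<Rightarrow> ('a \<Rightarrow> real) \<Rightarrow> ('a \<Rightarrow> real) \<Rightarrow>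
     (('a \<Rightarrow> real) \<Rightarrow> ('a \<Rightarrow> real) \<Rightarrow> real) \<Rightarrow> ('a \<Rightarrow> real) set \<Rightarrow> bool" where
  "weak_max_principle \<O> \<Sigma> w10 w11 \<bb> \<KK> \<longleftrightarrow>
     (\<forall>u\<in>\<KK>.
        (\<forall>v\<in>H1_0 \<O> \<Sigma> w10 w11. (AE x in lebesgue_on \<O>. 0 \<le> v x) \<longrightarrow> \<bb> u v \<le> 0) \<longrightarrow>
        boundary_nonpos \<O> \<Sigma> w10 w11 u \<longrightarrow>
        (AE x in lebesgue_on \<O>. u x \<le> 0))"

end

theory Submission
  imports Defs
begin

text \<open>
  The idea is to conjugate with \<open>\<phi>\<close>. If \<open>u\<close> is a subsolution for \<open>\<aa>\<close>, then \<open>\<phi> u\<close> is a subsolution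
  for the perturbed form \<open>\<aa>(u, v) + (B u, v)\<close>: by the identity that defines \<open>B\<close>, testing
  \<open>\<phi> u\<close> against \<open>v\<close> in the perturbed form is testing \<open>u\<close> against \<open>\<phi> v\<close> in \<open>\<aa>\<close>, and \<open>\<phi> v\<close> is again
  an admissible nonnegative test function. The growth condition \<open>u \<le> C (1 + 1/\<phi>)\<close> says that
  \<open>\<phi> u \<le> C (\<phi> + 1)\<close>, which is bounded because \<open>\<phi> \<le> 1\<close>. As \<open>\<phi> > 0\<close>, the positive part of \<open>\<phi> u\<close> is
  \<open>\<phi>\<close> times that of \<open>u\<close>, so the boundary condition carries over as well. The weak maximum
  principle for the perturbed form thus gives \<open>\<phi> u \<le> 0\<close>, and dividing by \<open>\<phi>\<close> gives \<open>u \<le> 0\<close>.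
\<close>

lemma has_H1_gradient_cong:
  assumes "\<And>x. x \<in> \<O> \<Longrightarrow> u x = u' x"
  shows "has_H1_gradient \<O> w10 w11 u g \<longleftrightarrow> has_H1_gradient \<O> w10 w11 u' g"
    and "H1_converges \<O> w10 w11 \<psi> u g \<longleftrightarrow> H1_converges \<O> w10 w11 \<psi> u' g"
proof -
  have conv: "H1_converges \<O> w10 w11 \<psi> u g \<longleftrightarrow> H1_converges \<O> w10 w11 \<psi> u' g" for \<psi>
    unfolding H1_converges_def
    by (intro arg_cong[where f = "\<lambda>s. s \<longlonglongrightarrow> 0"] ext nn_integral_cong) (simp add: assms)
  have "u \<in> borel_measurable (lebesgue_on \<O>) \<longleftrightarrow> u' \<in> borel_measurable (lebesgue_on \<O>)"
    by (rule measurable_cong) (simp add: assms)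
  with conv show "has_H1_gradient \<O> w10 w11 u g \<longleftrightarrow> has_H1_gradient \<O> w10 w11 u' g"
    by (simp add: has_H1_gradient_def)
  show "H1_converges \<O> w10 w11 \<psi> u g \<longleftrightarrow> H1_converges \<O> w10 w11 \<psi> u' g"
    by (rule conv)
qed

text \<open>
  Needed because \<open>\<phi>\<close> may be negative outside \<open>\<O>\<close>, so that \<open>(\<phi> u)\<^sup>+ = \<phi> u\<^sup>+\<close> is an identity on
  \<open>\<O>\<close> only, not between functions on the whole space.
\<close>

lemma H1_0_cong:
  assumes "\<And>x. x \<in> \<O> \<Longrightarrow> u x = u' x"
  shows "u \<in> H1_0 \<O> \<Sigma> w10 w11 \<longleftrightarrow> u' \<in> H1_0 \<O> \<Sigma> w10 w11"
  by (simp add: H1_0_def has_H1_gradient_cong[of \<O> u u', OF assms])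

lemma boundary_nonpos_mult:
  assumes "\<forall>x\<in>\<O>. 0 < \<phi> x"
    and "\<forall>v\<in>H1_0 \<O> \<Sigma> w10 w11. (\<lambda>x. \<phi> x * v x) \<in> H1_0 \<O> \<Sigma> w10 w11"
    and "boundary_nonpos \<O> \<Sigma> w10 w11 u"
  shows "boundary_nonpos \<O> \<Sigma> w10 w11 (\<lambda>x. \<phi> x * u x)"
proof -
  have "\<phi> x * max (u x) 0 = max (\<phi> x * u x) 0" if "x \<in> \<O>" for x
    using assms(1) that by (simp add: max_mult_distrib_left less_le_not_le)
  then have "(\<lambda>x. \<phi> x * max (u x) 0) \<in> H1_0 \<O> \<Sigma> w10 w11
    \<longleftrightarrow> boundary_nonpos \<O> \<Sigma> w10 w11 (\<lambda>x. \<phi> x * u x)"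
    unfolding boundary_nonpos_def by (rule H1_0_cong)
  with bspec[OF assms(2) assms(3)[unfolded boundary_nonpos_def]] show ?thesis
    by iprover
qed

lemma growth_bound_mult:
  fixes p t C :: real
  assumes "0 < p" "p \<le> 1" "t \<le> C * (1 + inverse p)"
  shows "p * t \<le> 2 * \<bar>C\<bar>"
proof -
  have "p * t \<le> p * (C * (1 + inverse p))"
    using assms by (intro mult_left_mono) auto
  also have "\<dots> = C * (p + 1)"
    using assms(1) by (simp add: field_simps)
  also have "\<dots> \<le> \<bar>C\<bar> * 2"
    using assms by (intro mult_mono) auto
  finally show ?thesis by simp
qed

theorem theorem6p11:
  fixes \<O> \<Sigma> :: "'a::euclidean_space set"
    and w00 w10 w11 \<phi> :: "'a \<Rightarrow> real"
    and \<aa> :: "('a \<Rightarrow> real) \<Rightarrow> ('a \<Rightarrow> real) \<Rightarrow> real"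
    and B :: "('a \<Rightarrow> real) \<Rightarrow> ('a \<Rightarrow> real)"
  assumes "open \<O>"
    and "openin (top_of_set (frontier \<O>)) \<Sigma>"
    and "weight_function \<O> w00" and "weight_function \<O> w10" and "weight_function \<O> w11"
    and "bilinear_map_on_H1 \<O> w10 w11 \<aa>"
    and "C_k 2 \<O> \<phi>" and "\<forall>x\<in>\<O>. 0 < \<phi> x \<and> \<phi> x \<le> 1"
    and "\<forall>u\<in>H1 \<O> w10 w11. (\<lambda>x. \<phi> x * u x) \<in> H1 \<O> w10 w11"
    and "\<forall>v\<in>H1_0 \<O> \<Sigma> w10 w11. (\<lambda>x. \<phi> x * v x) \<in> H1_0 \<O> \<Sigma> w10 w11"
    and "first_order_operator \<O> w00 w10 w11 B"
    and "\<forall>u\<in>H1 \<O> w10 w11. \<forall>v\<in>H1_0 \<O> \<Sigma> w10 w11.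
           \<aa> (\<lambda>x. \<phi> x * u x) v + L2_inner \<O> w00 (B (\<lambda>x. \<phi> x * u x)) v = \<aa> u (\<lambda>x. \<phi> x * v x)"
    and "weak_max_principle \<O> \<Sigma> w10 w11
           (\<lambda>u v. \<aa> u v + L2_inner \<O> w00 (B u) v)
           {u \<in> H1 \<O> w10 w11. \<exists>M. AE x in lebesgue_on \<O>. u x \<le> M}"
  shows "weak_max_principle \<O> \<Sigma> w10 w11 \<aa>
           {u \<in> H1 \<O> w10 w11. \<exists>C. AE x in lebesgue_on \<O>. u x \<le> C * (1 + inverse (\<phi> x))}"
proof -
  let ?M = "lebesgue_on \<O>"
  let ?V = "H1 \<O> w10 w11" and ?W = "H1_0 \<O> \<Sigma> w10 w11"
  have pos: "\<forall>x\<in>\<O>. 0 < \<phi> x" using assms(8) by blast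
  have in_\<O>: "AE x in ?M. x \<in> \<O>" using AE_space[of ?M] by simp
  show ?thesis
    unfolding weak_max_principle_def
  proof (intro ballI impI)
    fix u
    assume u: "u \<in> {u \<in> ?V. \<exists>C. AE x in ?M. u x \<le> C * (1 + inverse (\<phi> x))}"
      and sub: "\<forall>v\<in>?W. (AE x in ?M. 0 \<le> v x) \<longrightarrow> \<aa> u v \<le> 0"
      and bd: "boundary_nonpos \<O> \<Sigma> w10 w11 u"
    have uV: "u \<in> ?V" using u by blast
    define \<phi>u where "\<phi>u = (\<lambda>x. \<phi> x * u x)"
    obtain C where C: "AE x in ?M. u x \<le> C * (1 + inverse (\<phi> x))" using u by blast
    have "AE x in ?M. \<phi>u x \<le> 2 * \<bar>C\<bar>"
      using C in_\<O> by eventually_elim (use assms(8) growth_bound_mult in \<open>auto simp: \<phi>u_def\<close>)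
    then have mem: "\<phi>u \<in> {u \<in> ?V. \<exists>M. AE x in ?M. u x \<le> M}"
      using bspec[OF assms(9) uV] by (auto simp: \<phi>u_def)
    have "\<aa> \<phi>u v + L2_inner \<O> w00 (B \<phi>u) v \<le> 0"
      if v: "v \<in> ?W" and v_nonneg: "AE x in ?M. 0 \<le> v x" for v
    proof -
      have "AE x in ?M. 0 \<le> \<phi> x * v x"
        using v_nonneg in_\<O> by eventually_elim (use pos in \<open>simp add: less_imp_le\<close>)
      then have "\<aa> u (\<lambda>x. \<phi> x * v x) \<le> 0"
        using bspec[OF sub bspec[OF assms(10) v]] by iprover
      moreover have "\<aa> \<phi>u v + L2_inner \<O> w00 (B \<phi>u) v = \<aa> u (\<lambda>x. \<phi> x * v x)"
        unfolding \<phi>u_def by (rule bspec[OF bspec[OF assms(12) uV] v])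
      ultimately show ?thesis by simp
    qed
    moreover have "boundary_nonpos \<O> \<Sigma> w10 w11 \<phi>u"
      unfolding \<phi>u_def using pos assms(10) bd by (rule boundary_nonpos_mult)
    ultimately have "AE x in ?M. \<phi>u x \<le> 0"
      using assms(13) mem unfolding weak_max_principle_def by blast
    then show "AE x in ?M. u x \<le> 0"
      using in_\<O> by eventually_elim (use pos in \<open>auto simp: \<phi>u_def mult_le_0_iff dest: less_imp_le\<close>)
  qed
qed

end
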